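(* The sequence of classes $(D_k)_{k\ge -1}$ is strictly increasing: $$D_{-1}\subsetneq D_0\subsetneq D_1\subsetneq D_2\subsetneq\cdots\subsetneq D_k\subsetneq D_{k+1}\subsetneq\cdots,$$ i.e. $D_{k-1}\subsetneq D_k$ for every integer $k\ge 0$.
   Context: All graphs are finite, undirected, without loops or multiple edges, with at least one vertex. For a graph $X$ and a vertex $x$, $N_X(x)$ is the set of neighbours of $x$, identified with the subgraph of $X$ it induces, and $N_X[x]=N_X(x)\cup\{x\}$. A graph $X$ is a cone if it has a vertex $x$ with $N_X[x]=V(X)$; the one-vertex graph is a cone. Let $D_{-1}$ be the class of cones. Inductively, for an integer $k\ge 0$: a vertex $x$ of $X$ is $k$-dismantlable if $N_X(x)$ is non-empty and the graph $N_X(x)$ belongs to $D_{k-1}$; a graph is $k$-dismantlable if it can be reduced to a single vertex by successively deleting vertices, each being $k$-dismantlable in the current graph; $D_k$ is the class of $k$-dismantlable graphs. *)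

theory Defs
  imports
    "Graph_Theory.Pair_Digraph"
    "Graph_Theory.Digraph_Component"
    "HOL-Library.Infinite_Typeclass"
begin

text \<open>
  The locale predicate \<^const>\<open>pair_graph\<close> expresses: finitely many vertices, arcs are pairs of
  vertices, the arc relation is symmetric and irreflexive. It admits the empty graph, which is
  excluded here.
\<close>

definition simple_graph :: "'a pair_pre_digraph \<Rightarrow> bool" where
  "simple_graph X \<longleftrightarrow> pair_graph X \<and> pverts X \<noteq> {}"

definition neighbours :: "'a pair_pre_digraph \<Rightarrow> 'a \<Rightarrow> 'a set" where
  "neighbours X x = {y. (x, y) \<in> parcs X}"

definition closed_neighbours :: "'a pair_pre_digraph \<Rightarrow> 'a \<Rightarrow> 'a set" where
  "closed_neighbours X x = neighbours X x \<union> {x}"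

definition pair_induce :: "'a pair_pre_digraph \<Rightarrow> 'a set \<Rightarrow> 'a pair_pre_digraph" where
  "pair_induce X S = \<lparr> pverts = S, parcs = {(u, v) \<in> parcs X. u \<in> S \<and> v \<in> S} \<rparr>"

definition pair_del_vert :: "'a pair_pre_digraph \<Rightarrow> 'a \<Rightarrow> 'a pair_pre_digraph" where
  "pair_del_vert X x = pair_induce X (pverts X - {x})"

lemma with_proj_pair_induce:
  "with_proj (pair_induce X S) = with_proj X \<restriction> S"
  by (auto simp: with_proj_def pair_induce_def induce_subgraph_def)

lemma with_proj_pair_del_vert:
  assumes "pair_wf_digraph X"
  shows "with_proj (pair_del_vert X x) = pre_digraph.del_vert (with_proj X) x"
proof -
  interpret pair_wf_digraph X by fact
  show ?thesis
    by (auto simp: with_proj_def pair_del_vert_def pair_induce_def pre_digraph.del_vert_def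
        dest: in_arcsD1 in_arcsD2)
qed

definition cone :: "'a pair_pre_digraph \<Rightarrow> bool" where
  "cone X \<longleftrightarrow> simple_graph X \<and> (\<exists>x\<in>pverts X. closed_neighbours X x = pverts X)"

text \<open>
  In the following two notions the parameter \<open>C\<close> is the class to which the neighbourhood of a
  deleted vertex has to belong; it will be the preceding class of the hierarchy.
\<close>

definition dismantlable_vertex ::
    "'a pair_pre_digraph set \<Rightarrow> 'a pair_pre_digraph \<Rightarrow> 'a \<Rightarrow> bool" where
  "dismantlable_vertex C X x \<longleftrightarrow>
     x \<in> pverts X \<and> neighbours X x \<noteq> {} \<and> pair_induce X (neighbours X x) \<in> C"

inductive reduces_to_vertex :: "'a pair_pre_digraph set \<Rightarrow> 'a pair_pre_digraph \<Rightarrow> bool"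
  for C where
  single: "pverts X = {x} \<Longrightarrow> reduces_to_vertex C X"
| delete: "dismantlable_vertex C X x \<Longrightarrow> reduces_to_vertex C (pair_del_vert X x)
    \<Longrightarrow> reduces_to_vertex C X"

primrec dismantlable_level :: "nat \<Rightarrow> 'a pair_pre_digraph set" where
  "dismantlable_level 0 = {X. cone X}"
| "dismantlable_level (Suc n) =
     {X. simple_graph X \<and> reduces_to_vertex (dismantlable_level n) X}"

text \<open>
  The class \<open>D\<^sub>k\<close> for \<open>k \<ge> -1\<close>. The recursion above is shifted by one because it
  runs over the natural numbers. Indices below \<open>-1\<close> carry no meaning.
  The classes are relative to the vertex type; every finite graph has an isomorphic copy over an
  infinite vertex type (class \<^class>\<open>infinite\<close>), while over a finite one there are too few
  vertices to separate all levels.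
\<close>

definition dismantlable :: "int \<Rightarrow> 'a pair_pre_digraph set" where
  "dismantlable k = dismantlable_level (nat (k + 1))"

lemma dismantlable_minus_one: "dismantlable (- 1) = {X. cone X}"
  by (simp add: dismantlable_def)

lemma dismantlable_nonneg:
  assumes "0 \<le> k"
  shows "dismantlable k = {X. simple_graph X \<and> reduces_to_vertex (dismantlable (k - 1)) X}"
proof -
  have "nat (k + 1) = Suc (nat k)" using assms by simp
  then show ?thesis by (simp add: dismantlable_def)
qed

end

theory Submission
  imports Defs
begin

text \<open>
  Inclusion rests on dominated vertices: if every neighbour of \<open>x\<close> other than its neighbour \<open>y\<close> is
  adjacent to \<open>y\<close>, then the neighbourhood of \<open>x\<close> is a cone with apex \<open>y\<close>, so \<open>x\<close> may be deleted at
  every level (\<open>reduces_to_vertex_dominated\<close>). In a cone every vertex is dominated by the apex, hence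
  cones are \<open>0\<close>-dismantlable, and \<open>D\<^sub>k\<^sub>-\<^sub>1 \<subseteq> D\<^sub>k\<close> follows by induction.

  Strictness is witnessed by the \<open>n\<close>-cubion: its vertices are the \<open>2n\<close> facets and the \<open>2\<^sup>n\<close> corners of
  the \<open>n\<close>-dimensional cube; two facets are adjacent unless they are equal or opposite, any two distinct
  corners are adjacent, and a corner is adjacent to the facets that contain it. For \<open>n \<ge> 1\<close> it belongs to
  \<open>D\<^sub>n\<^sub>-\<^sub>1\<close> but not to the preceding class. The key is that the neighbourhood of a facet is an
  \<open>(n-1)\<close>-cubion.

  Membership: once a facet is deleted, each corner on it is dominated by the corner mirrored in the
  direction of that facet, and what remains after deleting these corners is a cone whose apex is the
  opposite facet.

  Non-membership, by induction on \<open>n\<close>: no vertex can be deleted first. A facet cannot, because its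
  neighbourhood is a smaller cubion. A corner cannot, because its neighbourhood lies in no \<open>D\<^sub>k\<close> at all.
  The invariant that shows this is the parity of the number of cliques, the empty one included: the
  cliques of \<open>X\<close> are those of \<open>X - x\<close> together with \<open>{x} \<union> K\<close> for the cliques \<open>K\<close> of the neighbourhood of
  \<open>x\<close>, so the number is even for every dismantlable graph
  (\<open>even_card_cliques_dismantlable_level\<close>), while it is odd for the neighbourhood of a corner
  (\<open>odd_card_cliques_corner_neighbourhood\<close>). This is the parity of the reduced Euler
  characteristic of the clique complex, which vanishes for contractible complexes; the neighbourhood of a
  corner has instead the homotopy type of an \<open>(n-1)\<close>-sphere.
\<close>

section \<open>Induced subgraphs and neighbourhoods\<close>

lemma pair_graph_iff:
  "pair_graph X \<longleftrightarrow> finite (pverts X) \<and> parcs X \<subseteq> pverts X \<times> pverts X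
     \<and> sym (parcs X) \<and> irrefl (parcs X)"  (is "_ \<longleftrightarrow> ?R")
proof
  assume "pair_graph X"
  then interpret pair_graph X .
  show ?R
  proof (intro conjI)
    show "parcs X \<subseteq> pverts X \<times> pverts X" by (auto dest: in_arcsD1 in_arcsD2)
    show "sym (parcs X)" using pair_sym_arcs by (simp add: symmetric_def)
    show "irrefl (parcs X)" using pair_no_loops unfolding irrefl_def by force
  qed (rule pair_finite_verts)
next
  assume R: ?R
  then have "finite (parcs X)" using finite_subset by blast
  with R show "pair_graph X"
    by unfold_locales (auto simp: symmetric_def irrefl_def)
qed

lemma pverts_pair_induce [simp]: "pverts (pair_induce X S) = S"
  and parcs_pair_induce [simp]: "(u, v) \<in> parcs (pair_induce X S) \<longleftrightarrow> (u, v) \<in> parcs X \<and> u \<in> S \<and> v \<in> S"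
  by (simp_all add: pair_induce_def)

lemma pair_graph_pair_induce: "pair_graph X \<Longrightarrow> S \<subseteq> pverts X \<Longrightarrow> pair_graph (pair_induce X S)"
  unfolding pair_graph_iff
  by (auto simp: sym_def irrefl_def dest: finite_subset)

lemma pair_induce_pair_induce: "T \<subseteq> S \<Longrightarrow> pair_induce (pair_induce X S) T = pair_induce X T"
  by (auto simp: pair_induce_def)

lemma pair_induce_pverts: "pair_graph X \<Longrightarrow> pair_induce X (pverts X) = X"
  by (rule pair_pre_digraph.equality) (auto simp: pair_graph_iff pair_induce_def)

lemma neighbours_subset: "pair_graph X \<Longrightarrow> neighbours X x \<subseteq> pverts X - {x}"
  by (auto simp: pair_graph_iff neighbours_def irrefl_def)

lemma coneI:
  assumes "pair_graph X" and "x \<in> pverts X"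
    and "\<And>y. y \<in> pverts X \<Longrightarrow> y \<noteq> x \<Longrightarrow> (x, y) \<in> parcs X"
  shows "cone X"
  using assms neighbours_subset[OF assms(1), of x]
  by (auto simp: cone_def simple_graph_def closed_neighbours_def neighbours_def intro!: bexI[of _ x])

section \<open>Dominated vertices and monotonicity\<close>

lemma reduces_to_vertex_mono:
  assumes "reduces_to_vertex C X" and "C \<subseteq> C'"
  shows "reduces_to_vertex C' X"
  using assms(1)
proof (induction rule: reduces_to_vertex.induct)
  case (single X x)
  then show ?case by (rule reduces_to_vertex.single)
next
  case (delete X x)
  then have "dismantlable_vertex C' X x" using assms(2) by (auto simp: dismantlable_vertex_def)
  then show ?case using delete.IH by (rule reduces_to_vertex.delete)
qed

text \<open>
  Dominated vertices can be deleted in any order, because the dominating vertices lie in \<open>W\<close> and are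
  never deleted themselves, so that domination persists in the smaller graphs.
\<close>
lemma reduces_to_vertex_dominated:
  assumes "reduces_to_vertex C (pair_induce X W)" and C: "{X. cone X} \<subseteq> C"
    and "pair_graph X" and "W \<subseteq> pverts X"
    and "\<And>x. x \<in> pverts X - W \<Longrightarrow>
      \<exists>y\<in>W. (x, y) \<in> parcs X \<and> (\<forall>z. (x, z) \<in> parcs X \<longrightarrow> z = y \<or> (z, y) \<in> parcs X)"
  shows "reduces_to_vertex C X"
proof -
  \<comment> \<open>\<open>W\<close> stays fixed while \<open>X\<close> loses the vertices outside \<open>W\<close> one by one.\<close>
  have "finite (pverts X - W)" using assms(3) by (simp add: pair_graph_iff)
  from this assms(1,3-5) show ?thesis
  proof (induction "pverts X - W" arbitrary: X rule: finite_induct)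
    case empty
    then have "pverts X = W" by auto
    with empty show ?case by (metis pair_induce_pverts)
  next
    case (insert x R)
    let ?X' = "pair_del_vert X x"
    have x: "x \<in> pverts X" "x \<notin> W" using insert.hyps by auto
    then obtain y where y: "y \<in> W" "(x, y) \<in> parcs X"
      and dom: "\<And>z. (x, z) \<in> parcs X \<Longrightarrow> z = y \<or> (z, y) \<in> parcs X"
      using insert.prems(4)[of x] by auto
    have sym: "(u, v) \<in> parcs X \<Longrightarrow> (v, u) \<in> parcs X" for u v
      using insert.prems(2) by (auto simp: pair_graph_iff sym_def)
    have N: "neighbours X x \<subseteq> pverts X" using neighbours_subset[OF insert.prems(2)] by auto
    have "cone (pair_induce X (neighbours X x))"
      by (rule coneI[of _ y])
        (use y dom sym insert.prems(2) N in \<open>auto simp: neighbours_def intro: pair_graph_pair_induce\<close>)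
    with x y C have "dismantlable_vertex C X x"
      by (auto simp: dismantlable_vertex_def neighbours_def)
    moreover have "reduces_to_vertex C ?X'"
    proof (rule insert.hyps(3))
      show "R = pverts ?X' - W" using insert.hyps by (auto simp: pair_del_vert_def)
      show "pair_graph ?X'"
        using insert.prems(2) by (auto simp: pair_del_vert_def intro: pair_graph_pair_induce)
      show W: "W \<subseteq> pverts ?X'" using x insert.prems(3) by (auto simp: pair_del_vert_def)
      then show "reduces_to_vertex C (pair_induce ?X' W)"
        using insert.prems(1) by (simp add: pair_del_vert_def pair_induce_pair_induce)
      fix u assume u: "u \<in> pverts ?X' - W"
      then have "u \<in> pverts X - W" by (auto simp: pair_del_vert_def)
      from insert.prems(4)[OF this] u W
      show "\<exists>y\<in>W. (u, y) \<in> parcs ?X' \<and> (\<forall>z. (u, z) \<in> parcs ?X' \<longrightarrow> z = y \<or> (z, y) \<in> parcs ?X')"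
        by (auto simp: pair_del_vert_def)
    qed
    ultimately show ?case by (rule reduces_to_vertex.delete)
  qed
qed

lemma cone_reduces_to_vertex:
  assumes "cone X" and "{X. cone X} \<subseteq> C"
  shows "reduces_to_vertex C X"
proof -
  obtain x where X: "pair_graph X" "x \<in> pverts X" "closed_neighbours X x = pverts X"
    using assms by (auto simp: cone_def simple_graph_def)
  have adj: "u = x \<or> (u, x) \<in> parcs X" if "u \<in> pverts X" for u
    using X that by (auto simp: closed_neighbours_def neighbours_def pair_graph_iff sym_def)
  show ?thesis
  proof (rule reduces_to_vertex_dominated[where W = "{x}"])
    show "reduces_to_vertex C (pair_induce X {x})"
      by (rule reduces_to_vertex.single[of _ x]) simp
  qed (use assms X adj in \<open>auto simp: pair_graph_iff\<close>)
qed

lemma dismantlable_level_simple_graph: "X \<in> dismantlable_level n \<Longrightarrow> simple_graph X"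
  by (cases n) (auto simp: cone_def)

lemma dismantlable_level_Suc_mono: "dismantlable_level n \<subseteq> dismantlable_level (Suc n)"
proof (induction n)
  case 0
  have "simple_graph X" if "cone X" for X :: "'a pair_pre_digraph"
    using that by (simp add: cone_def)
  then show ?case by (auto intro: cone_reduces_to_vertex)
next
  case (Suc n)
  then show ?case by (auto intro: reduces_to_vertex_mono)
qed

lemma cone_dismantlable_level: "{X. cone X} \<subseteq> dismantlable_level n"
  by (metis dismantlable_level.simps(1) dismantlable_level_Suc_mono lift_Suc_mono_le le0)

section \<open>Parity of the number of cliques\<close>

definition cliques :: "'a pair_pre_digraph \<Rightarrow> 'a set set" where
  "cliques X = {K. K \<subseteq> pverts X \<and> (\<forall>u\<in>K. \<forall>v\<in>K. u \<noteq> v \<longrightarrow> (u, v) \<in> parcs X)}"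

lemma finite_cliques: "pair_graph X \<Longrightarrow> finite (cliques X)"
  by (rule finite_subset[of _ "Pow (pverts X)"]) (auto simp: cliques_def pair_graph_iff)

text \<open>
  A clique of \<open>X\<close> either avoids \<open>x\<close> or is \<open>x\<close> together with a clique among its neighbours. The empty
  clique, which corresponds to \<open>{x}\<close>, has to be counted for this.
\<close>
lemma card_cliques_delete:
  assumes X: "pair_graph X" and x: "x \<in> pverts X"
  shows "card (cliques X) =
    card (cliques (pair_del_vert X x)) + card (cliques (pair_induce X (neighbours X x)))"
proof -
  let ?D = "cliques (pair_del_vert X x)" and ?N = "cliques (pair_induce X (neighbours X x))"
  have sub: "neighbours X x \<subseteq> pverts X - {x}" by (rule neighbours_subset[OF X])
  have sym: "(u, v) \<in> parcs X \<Longrightarrow> (v, u) \<in> parcs X" for u v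
    using X by (auto simp: pair_graph_iff sym_def)
  have x_notin: "x \<notin> K" if "K \<in> ?N" for K
    using that sub by (auto simp: cliques_def)
  have split: "cliques X = ?D \<union> insert x ` ?N"
  proof (intro equalityI subsetI)
    fix K assume K: "K \<in> cliques X"
    show "K \<in> ?D \<union> insert x ` ?N"
    proof (cases "x \<in> K")
      case True
      then have "K - {x} \<in> ?N" using K by (auto simp: cliques_def neighbours_def)
      moreover have "K = insert x (K - {x})" using True by auto
      ultimately show ?thesis by blast
    next
      case False
      then have "K \<in> ?D" using K by (auto simp: cliques_def pair_del_vert_def)
      then show ?thesis by simp
    qed
  next
    fix K assume "K \<in> ?D \<union> insert x ` ?N"
    then show "K \<in> cliques X"
      using sub x sym by (auto simp: cliques_def neighbours_def pair_del_vert_def subset_iff)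
  qed
  have "finite ?D" "finite ?N"
    using X sub by (auto simp: pair_del_vert_def intro!: finite_cliques pair_graph_pair_induce)
  moreover have "?D \<inter> insert x ` ?N = {}" by (auto simp: cliques_def pair_del_vert_def)
  moreover have "inj_on (insert x) ?N"
    by (rule inj_onI) (metis x_notin insert_ident)
  ultimately show ?thesis
    by (simp add: split card_Un_disjoint card_image)
qed

text \<open>
  For an apex \<open>x\<close>, the neighbourhood of \<open>x\<close> and the graph without \<open>x\<close> coincide, so the two summands in
  \<open>card_cliques_delete\<close> are equal.
\<close>
lemma even_card_cliques_cone:
  assumes "cone X"
  shows "even (card (cliques X))"
proof -
  obtain x where X: "pair_graph X" "x \<in> pverts X" "closed_neighbours X x = pverts X"
    using assms by (auto simp: cone_def simple_graph_def)
  then have "neighbours X x = pverts X - {x}"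
    using neighbours_subset[OF X(1), of x] by (auto simp: closed_neighbours_def)
  then show ?thesis
    using card_cliques_delete[OF X(1,2)] by (simp add: pair_del_vert_def)
qed

lemma even_card_cliques_reduces_to_vertex:
  assumes "reduces_to_vertex C X" and "pair_graph X"
    and "\<And>Y. Y \<in> C \<Longrightarrow> even (card (cliques Y))"
  shows "even (card (cliques X))"
  using assms
proof (induction rule: reduces_to_vertex.induct)
  case (single X x)
  then have "cliques X = {{}, {x}}" by (auto simp: cliques_def)
  then show ?case by simp
next
  case (delete X x)
  then have "pair_graph (pair_del_vert X x)"
    by (auto simp: pair_del_vert_def intro: pair_graph_pair_induce)
  with delete show ?case
    by (auto simp: dismantlable_vertex_def card_cliques_delete)
qed

lemma even_card_cliques_dismantlable_level:
  "X \<in> dismantlable_level n \<Longrightarrow> even (card (cliques X))"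
proof (induction n arbitrary: X)
  case 0
  then show ?case by (simp add: even_card_cliques_cone)
next
  case (Suc n)
  then show ?case
    by (auto simp: simple_graph_def intro: even_card_cliques_reduces_to_vertex)
qed

text \<open>
  A clique consists of a part \<open>A \<subseteq> P\<close> and an arbitrary set of common neighbours of \<open>A\<close> in \<open>Q\<close>. If \<open>A\<close> has
  \<open>m\<close> common neighbours in \<open>Q\<close>, then \<open>A\<close> contributes \<open>2\<^sup>m\<close> cliques, an odd number only for \<open>m = 0\<close>, that is,
  for \<open>A = P\<close>.
\<close>
lemma odd_card_cliques_two_cliques:
  assumes X: "pair_graph X" and V: "pverts X = P \<union> Q" "P \<inter> Q = {}"
    and P: "\<And>u v. u \<in> P \<Longrightarrow> v \<in> P \<Longrightarrow> u \<noteq> v \<Longrightarrow> (u, v) \<in> parcs X"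
    and Q: "\<And>u v. u \<in> Q \<Longrightarrow> v \<in> Q \<Longrightarrow> u \<noteq> v \<Longrightarrow> (u, v) \<in> parcs X"
    and common: "\<And>A. A \<subseteq> P \<Longrightarrow> (\<exists>q\<in>Q. \<forall>p\<in>A. (p, q) \<in> parcs X) \<longleftrightarrow> A \<noteq> P"
  shows "odd (card (cliques X))"
proof -
  define M where "M A = {q\<in>Q. \<forall>p\<in>A. (p, q) \<in> parcs X}" for A
  have fin: "finite P" "finite Q" using X V by (auto simp: pair_graph_iff)
  have finM: "finite (M A)" for A using fin by (simp add: M_def)
  have sym: "(u, v) \<in> parcs X \<Longrightarrow> (v, u) \<in> parcs X" for u v
    using X by (auto simp: pair_graph_iff sym_def)
  have "bij_betw (\<lambda>K. (K \<inter> P, K \<inter> Q)) (cliques X) (SIGMA A:Pow P. Pow (M A))"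
  proof (rule bij_betw_byWitness[where f' = "\<lambda>(A, B). A \<union> B"])
    show "\<forall>K\<in>cliques X. (case (K \<inter> P, K \<inter> Q) of (A, B) \<Rightarrow> A \<union> B) = K"
      using V by (auto simp: cliques_def)
    show "\<forall>c\<in>SIGMA A:Pow P. Pow (M A).
        ((case c of (A, B) \<Rightarrow> A \<union> B) \<inter> P, (case c of (A, B) \<Rightarrow> A \<union> B) \<inter> Q) = c"
      using V by (auto simp: M_def)
    show "(\<lambda>K. (K \<inter> P, K \<inter> Q)) ` cliques X \<subseteq> (SIGMA A:Pow P. Pow (M A))"
    proof -
      have "p \<noteq> q" if "p \<in> P" "q \<in> Q" for p q using that V(2) by auto
      then show ?thesis by (auto simp: M_def cliques_def)
    qed
    show "(\<lambda>(A, B). A \<union> B) ` (SIGMA A:Pow P. Pow (M A)) \<subseteq> cliques X"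
    proof
      fix K assume "K \<in> (\<lambda>(A, B). A \<union> B) ` (SIGMA A:Pow P. Pow (M A))"
      then obtain A B where K: "K = A \<union> B" and A: "A \<subseteq> P" and "B \<subseteq> M A"
        by auto
      then have B: "B \<subseteq> Q" "\<And>p q. p \<in> A \<Longrightarrow> q \<in> B \<Longrightarrow> (p, q) \<in> parcs X"
        by (auto simp: M_def)
      show "K \<in> cliques X"
        unfolding cliques_def K
      proof (intro CollectI conjI ballI impI)
        show "A \<union> B \<subseteq> pverts X" using V(1) A B(1) by auto
        fix u v assume "u \<in> A \<union> B" "v \<in> A \<union> B" "u \<noteq> v"
        then consider "u \<in> P" "v \<in> P" | "u \<in> Q" "v \<in> Q"
          | "u \<in> A" "v \<in> B" | "u \<in> B" "v \<in> A"
          using A B(1) by blast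
        then show "(u, v) \<in> parcs X"
          using \<open>u \<noteq> v\<close> by cases (simp_all add: P Q B(2) sym)
      qed
    qed
  qed
  then have "card (cliques X) = card (SIGMA A:Pow P. Pow (M A))" by (rule bij_betw_same_card)
  also have "\<dots> = (\<Sum>A\<in>Pow P. 2 ^ card (M A))"
    using fin finM by (simp add: card_Pow)
  also have "\<dots> = 2 ^ card (M P) + (\<Sum>A\<in>Pow P - {P}. 2 ^ card (M A))"
    using fin by (intro sum.remove) auto
  finally have eq: "card (cliques X) = 2 ^ card (M P) + (\<Sum>A\<in>Pow P - {P}. 2 ^ card (M A))" .
  have "M P = {}" using common[of P] by (auto simp: M_def)
  moreover have "M A \<noteq> {}" if "A \<in> Pow P - {P}" for A
    using common[of A] that by (auto simp: M_def)
  then have "even (\<Sum>A\<in>Pow P - {P}. 2 ^ card (M A))"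
    by (intro dvd_sum) (simp add: finM card_gt_0_iff)
  ultimately show ?thesis by (simp add: eq)
qed

section \<open>Cubions\<close>

text \<open>
  The cube has coordinates indexed by a set \<open>I\<close> of natural numbers. A corner is given by the set of its
  coordinates that are \<open>1\<close>, and \<open>Facet i e\<close> is the facet on which coordinate \<open>i\<close> is \<open>1\<close> if \<open>e\<close> holds and
  \<open>0\<close> otherwise.
\<close>
datatype cube_element = Facet nat bool | Corner "nat set"

fun cubion_adj :: "cube_element \<Rightarrow> cube_element \<Rightarrow> bool" where
  "cubion_adj (Facet i d) (Facet j e) \<longleftrightarrow> i \<noteq> j"
| "cubion_adj (Facet i e) (Corner S) \<longleftrightarrow> (i \<in> S \<longleftrightarrow> e)"
| "cubion_adj (Corner S) (Facet i e) \<longleftrightarrow> (i \<in> S \<longleftrightarrow> e)"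
| "cubion_adj (Corner S) (Corner T) \<longleftrightarrow> S \<noteq> T"

lemma cubion_adj_sym: "cubion_adj u v \<Longrightarrow> cubion_adj v u"
  by (cases u; cases v) auto

lemma cubion_adj_irrefl: "\<not> cubion_adj u u"
  by (cases u) auto

text \<open>
  Carrying the labelling \<open>f\<close> along makes isomorphisms unnecessary: an induced subgraph that is isomorphic
  to a smaller cubion is equal to that cubion with another labelling.
\<close>
definition labelled_cubion :: "cube_element set \<Rightarrow> (cube_element \<Rightarrow> 'a) \<Rightarrow> 'a pair_pre_digraph" where
  "labelled_cubion V f =
     \<lparr> pverts = f ` V, parcs = {(f u, f v) |u v. u \<in> V \<and> v \<in> V \<and> cubion_adj u v} \<rparr>"

definition cube_elements :: "nat set \<Rightarrow> cube_element set" where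
  "cube_elements I = {Facet i e |i e. i \<in> I} \<union> Corner ` Pow I"

lemma finite_cube_elements: "finite I \<Longrightarrow> finite (cube_elements I)"
proof -
  assume "finite I"
  moreover have "{Facet i e |i e. i \<in> I} = (\<lambda>(i, e). Facet i e) ` (I \<times> UNIV)" by auto
  ultimately show ?thesis by (simp add: cube_elements_def)
qed

lemma pverts_labelled_cubion [simp]: "pverts (labelled_cubion V f) = f ` V"
  by (simp add: labelled_cubion_def)

lemma parcs_labelled_cubion:
  assumes "inj_on f V" "u \<in> V" "v \<in> V"
  shows "(f u, f v) \<in> parcs (labelled_cubion V f) \<longleftrightarrow> cubion_adj u v"
  using assms by (auto simp: labelled_cubion_def inj_on_eq_iff)

lemma pair_graph_labelled_cubion:
  assumes "finite V" and "inj_on f V"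
  shows "pair_graph (labelled_cubion V f)"
  using assms cubion_adj_irrefl
  by (auto simp: pair_graph_iff labelled_cubion_def sym_def irrefl_def inj_on_eq_iff
      intro: cubion_adj_sym)

lemma neighbours_labelled_cubion:
  assumes "inj_on f V" and "u \<in> V"
  shows "neighbours (labelled_cubion V f) (f u) = f ` {v \<in> V. cubion_adj u v}"
  using assms by (auto simp: neighbours_def labelled_cubion_def inj_on_eq_iff)

lemma pair_induce_labelled_cubion:
  assumes "inj_on f V" and "W \<subseteq> V"
  shows "pair_induce (labelled_cubion V f) (f ` W) = labelled_cubion W f"
  using assms by (auto simp: pair_induce_def labelled_cubion_def inj_on_eq_iff subset_iff) blast+

lemma labelled_cubion_image:
  assumes "\<And>u v. u \<in> W \<Longrightarrow> v \<in> W \<Longrightarrow> cubion_adj (g u) (g v) \<longleftrightarrow> cubion_adj u v"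
  shows "labelled_cubion (g ` W) f = labelled_cubion W (f \<circ> g)"
  using assms by (auto simp: labelled_cubion_def image_comp)

lemma cone_labelled_cubion:
  assumes "finite V" "inj_on f V" "u \<in> V" and "\<And>v. v \<in> V \<Longrightarrow> v \<noteq> u \<Longrightarrow> cubion_adj u v"
  shows "cone (labelled_cubion V f)"
  using assms
  by (intro coneI[where x = "f u"] pair_graph_labelled_cubion)
    (force simp: parcs_labelled_cubion)+

text \<open>
  The face lattice identification behind the recursion: the facet \<open>Facet i e\<close> is itself a cube with
  coordinate set \<open>I - {i}\<close>. Its corners are the corners of the large cube on it, and its facets are its
  intersections with the facets \<open>Facet j d\<close> for \<open>j \<noteq> i\<close>.
\<close>
fun lift_to_facet :: "nat \<Rightarrow> bool \<Rightarrow> cube_element \<Rightarrow> cube_element" where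
  "lift_to_facet i e (Facet j d) = Facet j d"
| "lift_to_facet i e (Corner S) = Corner (if e then insert i S else S)"

lemma lift_to_facet_image:
  assumes "i \<in> I"
  shows "lift_to_facet i e ` cube_elements (I - {i}) =
    {v \<in> cube_elements I. cubion_adj (Facet i e) v}" (is "?L = ?R")
proof
  show "?L \<subseteq> ?R" using assms by (cases e) (auto simp: cube_elements_def)
  show "?R \<subseteq> ?L"
  proof
    fix v assume v: "v \<in> ?R"
    show "v \<in> ?L"
    proof (cases v)
      case (Facet j d)
      with v show ?thesis
        by (intro image_eqI[of _ _ v]) (auto simp: cube_elements_def)
    next
      case (Corner S)
      with v show ?thesis
        by (intro image_eqI[of _ _ "Corner (S - {i})"]) (auto simp: cube_elements_def)
    qed
  qed
qed

lemma cubion_adj_lift_to_facet: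
  assumes "u \<in> cube_elements (I - {i})" "v \<in> cube_elements (I - {i})"
  shows "cubion_adj (lift_to_facet i e u) (lift_to_facet i e v) \<longleftrightarrow> cubion_adj u v"
  using assms by (cases u; cases v; cases e) (auto simp: cube_elements_def)

lemma inj_on_lift_to_facet: "inj_on (lift_to_facet i e) (cube_elements (I - {i}))"
proof (rule inj_onI)
  fix u v
  assume uv: "u \<in> cube_elements (I - {i})" "v \<in> cube_elements (I - {i})"
    and eq: "lift_to_facet i e u = lift_to_facet i e v"
  show "u = v"
  proof (cases "\<exists>S T. u = Corner S \<and> v = Corner T")
    case True
    then obtain S T where ST: "u = Corner S" "v = Corner T" by auto
    with uv have "i \<notin> S" "i \<notin> T" by (auto simp: cube_elements_def)
    with eq ST show ?thesis by (cases e) (simp_all add: insert_ident)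
  next
    case False
    with eq show ?thesis by (cases u; cases v) auto
  qed
qed

lemma facet_neighbourhood:
  assumes "inj_on f (cube_elements I)" and "i \<in> I"
  shows "pair_induce (labelled_cubion (cube_elements I) f)
      (neighbours (labelled_cubion (cube_elements I) f) (f (Facet i e)))
    = labelled_cubion (cube_elements (I - {i})) (f \<circ> lift_to_facet i e)"
    and "inj_on (f \<circ> lift_to_facet i e) (cube_elements (I - {i}))"
proof -
  let ?W = "lift_to_facet i e ` cube_elements (I - {i})"
  have W: "?W = {v \<in> cube_elements I. cubion_adj (Facet i e) v}"
    by (rule lift_to_facet_image[OF assms(2)])
  have "Facet i e \<in> cube_elements I" using assms(2) by (auto simp: cube_elements_def)
  then have "neighbours (labelled_cubion (cube_elements I) f) (f (Facet i e)) = f ` ?W"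
    using assms(1) by (simp add: neighbours_labelled_cubion W)
  moreover have "pair_induce (labelled_cubion (cube_elements I) f) (f ` ?W) = labelled_cubion ?W f"
    by (rule pair_induce_labelled_cubion[OF assms(1)]) (auto simp: W)
  moreover have "labelled_cubion ?W f
      = labelled_cubion (cube_elements (I - {i})) (f \<circ> lift_to_facet i e)"
    by (rule labelled_cubion_image) (rule cubion_adj_lift_to_facet)
  ultimately show "pair_induce (labelled_cubion (cube_elements I) f)
      (neighbours (labelled_cubion (cube_elements I) f) (f (Facet i e)))
    = labelled_cubion (cube_elements (I - {i})) (f \<circ> lift_to_facet i e)" by simp
  have "inj_on f ?W" by (rule inj_on_subset[OF assms(1)]) (auto simp: W)
  then show "inj_on (f \<circ> lift_to_facet i e) (cube_elements (I - {i}))"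
    by (intro comp_inj_on inj_on_lift_to_facet)
qed

text \<open>
  The facets at the corner \<open>S\<close> form one clique and the other corners form a second one. A set of facets at
  \<open>S\<close> has a common corner besides \<open>S\<close> unless it contains all of them: if the facet in direction \<open>i\<close> is
  missing, flip coordinate \<open>i\<close> of \<open>S\<close>.
\<close>
lemma odd_card_cliques_corner_neighbourhood:
  assumes I: "finite I" and f: "inj_on f (cube_elements I)" and S: "S \<subseteq> I"
  shows "odd (card (cliques (pair_induce (labelled_cubion (cube_elements I) f)
      (neighbours (labelled_cubion (cube_elements I) f) (f (Corner S))))))"
proof -
  define F where "F = (\<lambda>i. Facet i (i \<in> S)) ` I"
  define G where "G = Corner ` (Pow I - {S})"
  let ?X = "labelled_cubion (F \<union> G) f"
  have sub: "F \<union> G \<subseteq> cube_elements I" by (auto simp: F_def G_def cube_elements_def)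
  have fFG: "inj_on f (F \<union> G)" by (rule inj_on_subset[OF f sub])
  have adj: "(f u, f v) \<in> parcs ?X \<longleftrightarrow> cubion_adj u v" if "u \<in> F \<union> G" "v \<in> F \<union> G" for u v
    by (rule parcs_labelled_cubion[OF fFG that])
  have "neighbours (labelled_cubion (cube_elements I) f) (f (Corner S))
      = f ` {v \<in> cube_elements I. cubion_adj (Corner S) v}"
    using S by (intro neighbours_labelled_cubion[OF f]) (auto simp: cube_elements_def)
  also have "{v \<in> cube_elements I. cubion_adj (Corner S) v} = F \<union> G"
    by (auto simp: F_def G_def cube_elements_def)
  finally have "pair_induce (labelled_cubion (cube_elements I) f)
      (neighbours (labelled_cubion (cube_elements I) f) (f (Corner S))) = ?X"
    using pair_induce_labelled_cubion[OF f sub] by simp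
  moreover have "odd (card (cliques ?X))"
  proof (rule odd_card_cliques_two_cliques[where P = "f ` F" and Q = "f ` G"])
    show "pair_graph ?X"
      using I by (intro pair_graph_labelled_cubion fFG) (auto simp: F_def G_def)
    show "pverts ?X = f ` F \<union> f ` G" by (simp add: image_Un)
    show "f ` F \<inter> f ` G = {}"
      using fFG by (subst inj_on_image_Int[OF fFG, symmetric]) (auto simp: F_def G_def)
    have complete: "(f u, f v) \<in> parcs ?X"
      if "u \<in> F \<and> v \<in> F \<or> u \<in> G \<and> v \<in> G" "f u \<noteq> f v" for u v
    proof -
      have "cubion_adj u v" using that unfolding F_def G_def by (elim disjE conjE imageE) auto
      then show ?thesis using adj[of u v] that(1) by blast
    qed
    show "(u, v) \<in> parcs ?X" if "u \<in> f ` F" "v \<in> f ` F" "u \<noteq> v" for u v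
      using that complete by blast
    show "(u, v) \<in> parcs ?X" if "u \<in> f ` G" "v \<in> f ` G" "u \<noteq> v" for u v
      using that complete by blast
    fix A assume "A \<subseteq> f ` F"
    then obtain J where J: "J \<subseteq> I" "A = (\<lambda>i. f (Facet i (i \<in> S))) ` J"
      unfolding F_def image_image subset_image_iff by blast
    have "(\<exists>q\<in>f ` G. \<forall>p\<in>A. (p, q) \<in> parcs ?X)
        \<longleftrightarrow> (\<exists>T\<in>Pow I - {S}. \<forall>i\<in>J. i \<in> T \<longleftrightarrow> i \<in> S)"
      using J adj by (auto simp: F_def G_def subset_iff)
    also have "\<dots> \<longleftrightarrow> J \<noteq> I"
    proof
      assume "J \<noteq> I"
      with J obtain i where i: "i \<in> I" "i \<notin> J" by auto
      define T where "T = (if i \<in> S then S - {i} else insert i S)"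
      have "T \<in> Pow I - {S}" "\<forall>j\<in>J. j \<in> T \<longleftrightarrow> j \<in> S" using i S by (auto simp: T_def)
      then show "\<exists>T\<in>Pow I - {S}. \<forall>i\<in>J. i \<in> T \<longleftrightarrow> i \<in> S" by blast
    qed (use S in blast)
    also have "\<dots> \<longleftrightarrow> A \<noteq> f ` F"
    proof -
      have "inj_on (\<lambda>i. f (Facet i (i \<in> S))) I"
        using fFG by (auto simp: inj_on_def F_def)
      then show ?thesis
        using J by (auto simp: F_def image_image inj_on_image_eq_iff)
    qed
    finally show "(\<exists>q\<in>f ` G. \<forall>p\<in>A. (p, q) \<in> parcs ?X) \<longleftrightarrow> A \<noteq> f ` F" .
  qed
  ultimately show ?thesis by simp
qed

text \<open>
  The deletions start with a facet, say \<open>Facet i True\<close>, whose neighbourhood is a smaller cubion. In its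
  presence a corner \<open>S\<close> on it is not dominated by the mirror image \<open>S - {i}\<close> on the opposite facet; afterwards
  it is, since every other facet through \<open>S\<close> also contains \<open>S - {i}\<close>.
\<close>
lemma cubion_in_dismantlable_level:
  assumes "finite I" and "inj_on f (cube_elements I)"
  shows "labelled_cubion (cube_elements I) f \<in> dismantlable_level (card I)"
  using assms
proof (induction "card I" arbitrary: I f)
  case 0
  then have "I = {}" by simp
  then show ?case
    by (auto simp: cube_elements_def intro: cone_labelled_cubion[of _ _ "Corner {}"])
next
  case (Suc n)
  let ?V = "cube_elements I"
  let ?X = "labelled_cubion ?V f"
  let ?C = "dismantlable_level n :: 'a pair_pre_digraph set"
  obtain i where i: "i \<in> I" using Suc.hyps(2) by (metis card.empty equals0I old.nat.distinct(2))
  have n: "n = card (I - {i})" using Suc.hyps(2) Suc.prems(1) i by simp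
  let ?a = "Facet i True" and ?b = "Facet i False"
  let ?V' = "?V - {?a}" and ?W = "?V - {?a} - {Corner S |S. i \<in> S}"
  have inj': "inj_on f ?V'" by (rule inj_on_subset[OF Suc.prems(2)]) auto
  have finV: "finite ?V" by (rule finite_cube_elements[OF Suc.prems(1)])
  have graph: "pair_graph ?X" by (rule pair_graph_labelled_cubion[OF finV Suc.prems(2)])
  have ab: "?a \<in> ?V" "?b \<in> ?V" using i by (auto simp: cube_elements_def)
  have N: "pair_induce ?X (neighbours ?X (f ?a)) \<in> ?C"
    unfolding facet_neighbourhood(1)[OF Suc.prems(2) i] n
    using Suc.prems n by (intro Suc.hyps(1) facet_neighbourhood(2) i) auto
  then have "neighbours ?X (f ?a) \<noteq> {}"
    using dismantlable_level_simple_graph[OF N] by (simp add: simple_graph_def)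
  with N ab have "dismantlable_vertex ?C ?X (f ?a)"
    by (auto simp: dismantlable_vertex_def)
  moreover have "pair_del_vert ?X (f ?a) = labelled_cubion ?V' f"
  proof -
    have "f ` ?V - {f ?a} = f ` ?V'"
      using inj_on_image_set_diff[OF Suc.prems(2), of ?V "{?a}"] ab by simp
    then show ?thesis
      using pair_induce_labelled_cubion[OF Suc.prems(2), of ?V'] by (simp add: pair_del_vert_def)
  qed
  moreover have "reduces_to_vertex ?C (labelled_cubion ?V' f)"
  proof (rule reduces_to_vertex_dominated[where W = "f ` ?W"])
    show "{X. cone X} \<subseteq> ?C" by (rule cone_dismantlable_level)
    have "cone (labelled_cubion ?W f)"
    proof (rule cone_labelled_cubion[of _ _ ?b])
      show "cubion_adj ?b v" if "v \<in> ?W" "v \<noteq> ?b" for v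
        using that by (cases v) (auto simp: cube_elements_def)
      show "inj_on f ?W" by (rule inj_on_subset[OF inj']) auto
    qed (use finV ab in auto)
    then show "reduces_to_vertex ?C (pair_induce (labelled_cubion ?V' f) (f ` ?W))"
      by (subst pair_induce_labelled_cubion[OF inj'])
        (auto intro: cone_reduces_to_vertex cone_dismantlable_level[THEN subsetD])
    show "pair_graph (labelled_cubion ?V' f)"
      using finV by (intro pair_graph_labelled_cubion inj') auto
    show "f ` ?W \<subseteq> pverts (labelled_cubion ?V' f)" by auto
    fix x assume "x \<in> pverts (labelled_cubion ?V' f) - f ` ?W"
    then obtain u where u: "x = f u" "u \<in> ?V' - ?W" by auto
    then obtain S where S: "u = Corner S" "i \<in> S" "S \<subseteq> I" by (auto simp: cube_elements_def)
    let ?T = "Corner (S - {i})"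
    have T: "?T \<in> ?W" using S by (auto simp: cube_elements_def)
    have "(x, f ?T) \<in> parcs (labelled_cubion ?V' f)"
      using u S T by (simp add: parcs_labelled_cubion[OF inj']) auto
    moreover have "z = f ?T \<or> (z, f ?T) \<in> parcs (labelled_cubion ?V' f)"
      if "(x, z) \<in> parcs (labelled_cubion ?V' f)" for z
    proof -
      have "z \<in> f ` {v \<in> ?V'. cubion_adj u v}"
        using that u neighbours_labelled_cubion[OF inj', of u] by (auto simp: neighbours_def)
      then obtain v where v: "z = f v" "v \<in> ?V'" "cubion_adj u v" by auto
      then have "v = ?T \<or> cubion_adj v ?T"
        using S by (cases v) auto
      then show ?thesis
        using v T parcs_labelled_cubion[OF inj', of v ?T] by auto
    qed
    ultimately show "\<exists>y\<in>f ` ?W. (x, y) \<in> parcs (labelled_cubion ?V' f) \<and>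
        (\<forall>z. (x, z) \<in> parcs (labelled_cubion ?V' f)
          \<longrightarrow> z = y \<or> (z, y) \<in> parcs (labelled_cubion ?V' f))"
      using T by blast
  qed
  ultimately have "reduces_to_vertex ?C ?X" by (metis reduces_to_vertex.delete)
  then show ?case
    unfolding Suc.hyps(2)[symmetric] using graph ab by (auto simp: simple_graph_def)
qed

text \<open>
  No apex exists: a facet is not adjacent to the opposite facet, and a corner is not adjacent to the facets
  that do not contain it.
\<close>
lemma cubion_not_cone:
  assumes f: "inj_on f (cube_elements I)" and "I \<noteq> {}"
  shows "\<not> cone (labelled_cubion (cube_elements I) f)"
proof
  let ?V = "cube_elements I"
  assume "cone (labelled_cubion ?V f)"
  then obtain u where u: "u \<in> ?V" "closed_neighbours (labelled_cubion ?V f) (f u) = f ` ?V"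
    by (auto simp: cone_def)
  obtain i where i: "i \<in> I" using assms by auto
  have "\<exists>v\<in>?V. v \<noteq> u \<and> \<not> cubion_adj u v"
  proof (cases u)
    case (Facet j e)
    with u show ?thesis by (intro bexI[of _ "Facet j (\<not> e)"]) (auto simp: cube_elements_def)
  next
    case (Corner S)
    with i show ?thesis by (intro bexI[of _ "Facet i (i \<notin> S)"]) (auto simp: cube_elements_def)
  qed
  then obtain v where v: "v \<in> ?V" "v \<noteq> u" "\<not> cubion_adj u v" by auto
  then have "f v \<in> f ` {v \<in> ?V. cubion_adj u v} \<union> {f u}"
    using u by (auto simp: closed_neighbours_def neighbours_labelled_cubion[OF f])
  with v u show False using f by (auto simp: inj_on_eq_iff)
qed

text \<open>
  A first deletion is impossible. The neighbourhood of a facet is excluded by the induction hypothesis, that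
  of a corner by the parity of its number of cliques.
\<close>
lemma cubion_notin_dismantlable_level:
  assumes "finite I" and "inj_on f (cube_elements I)" and "card I = Suc n"
  shows "labelled_cubion (cube_elements I) f \<notin> dismantlable_level n"
  using assms
proof (induction n arbitrary: I f)
  case 0
  then have "I \<noteq> {}" by auto
  with 0 show ?case using cubion_not_cone[of f I] by simp
next
  case (Suc n)
  let ?X = "labelled_cubion (cube_elements I) f"
  obtain i where i: "i \<in> I" using Suc.prems(3) by (metis card.empty equals0I old.nat.distinct(2))
  show ?case
  proof
    assume "?X \<in> dismantlable_level (Suc n)"
    then have "reduces_to_vertex (dismantlable_level n) ?X" by simp
    then show False
    proof cases
      case (single x)
      have "Facet i True \<in> cube_elements I" "Facet i False \<in> cube_elements I"
        using i by (auto simp: cube_elements_def)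
      moreover from this single have "f (Facet i True) = f (Facet i False)"
        by (metis imageI pverts_labelled_cubion singletonD)
      ultimately show False
        using Suc.prems(2) by (auto simp: inj_on_eq_iff)
    next
      case (delete x)
      then obtain u where u: "u \<in> cube_elements I" "x = f u"
        and N: "pair_induce ?X (neighbours ?X (f u)) \<in> dismantlable_level n"
        by (auto simp: dismantlable_vertex_def)
      show False
      proof (cases u)
        case (Facet j e)
        with u have j: "j \<in> I" by (auto simp: cube_elements_def)
        have "card (I - {j}) = Suc n" using j Suc.prems by simp
        then show False
          using N Suc.IH[OF _ facet_neighbourhood(2)[OF Suc.prems(2) j, of e]] Suc.prems(1)
          unfolding Facet facet_neighbourhood(1)[OF Suc.prems(2) j] by simp
      next
        case (Corner S)
        with u have "S \<subseteq> I" by (auto simp: cube_elements_def)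
        then show False
          using N Corner odd_card_cliques_corner_neighbourhood[OF Suc.prems(1,2)]
            even_card_cliques_dismantlable_level by blast
      qed
    qed
  qed
qed

lemma finite_set_embeds_in_infinite_type:
  assumes "finite V"
  obtains f :: "'b \<Rightarrow> 'a::infinite" where "inj_on f V"
proof -
  obtain U :: "'a set" where "finite U" "card U = card V"
    using infinite_arbitrarily_large[OF infinite_UNIV] by blast
  with assms that show thesis by (metis bij_betw_imp_inj_on finite_same_card_bij)
qed

theorem theorem11:
  fixes k :: int
  assumes "0 \<le> k"
  shows "(dismantlable (k - 1) :: 'a::infinite pair_pre_digraph set) \<subset> dismantlable k"
proof -
  define n where "n = nat k"
  have levels: "dismantlable (k - 1) = (dismantlable_level n :: 'a pair_pre_digraph set)"
    "dismantlable k = (dismantlable_level (Suc n) :: 'a pair_pre_digraph set)"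
    using assms by (simp_all add: dismantlable_def n_def nat_add_distrib)
  let ?I = "{..<Suc n}"
  obtain f :: "cube_element \<Rightarrow> 'a" where f: "inj_on f (cube_elements ?I)"
    using finite_set_embeds_in_infinite_type finite_cube_elements[of ?I] by blast
  have "labelled_cubion (cube_elements ?I) f \<in> dismantlable_level (Suc n)"
    using cubion_in_dismantlable_level[OF _ f] by simp
  moreover have "labelled_cubion (cube_elements ?I) f \<notin> dismantlable_level n"
    by (rule cubion_notin_dismantlable_level[OF _ f]) simp_all
  ultimately show ?thesis
    unfolding levels using dismantlable_level_Suc_mono by blast
qed

end
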